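(* Let $\beta>0$ and $\alpha>0$, let $g$ be a function on $(0,\beta]$ which is integrable on $[\delta,\beta]$ for every $0<\delta<\beta$, and define $f(x)=\alpha e^{-\alpha x}\,g(e^{-\alpha x})$ for $x\ge -\ln(\beta)/\alpha$ (that is, $f(x)=-g(\psi(x))\psi'(x)$ with $\psi(x)=e^{-\alpha x}$). Then the generalized finite-limit improper integral $Z\!\!\int_0^\beta g(u)\,du$ exists if and only if the generalized infinite-limit improper integral $Z\!\!\int_{-\ln(\beta)/\alpha}^{\infty} f(x)\,dx$ exists, and in that case $$Z\!\!\int_0^\beta g(u)\,du = Z\!\!\int_{-\ln(\beta)/\alpha}^{\infty} f(x)\,dx .$$
   Context: Initialization function: a finite real-valued function $w$ on $\mathbb{R}$ for which there is $\epsilon$ with $0<\epsilon\le 1$ such that $w(v)=0$ for $v<\epsilon$, $w(v)=1$ for $v\ge 1$, and $w'(v)\ge 0$ (i.e. $w$ is nondecreasing; $w'$ need not exist classically everywhere). Generalized finite-limit integral (critical lower limit $0$, noncritical upper limit $\beta$): for an initialization function $w$ (not depending on $\delta$), $$Z\!\!\int_{0}^{\beta} g(u)\,du = \lim_{\delta\to 0^+}\left\{\int_0^\delta g(u)\,w(u/\delta)\,du+\int_\delta^\beta g(u)\,du\right\},$$ where the integrals inside the limit are conventional ones (since $w(u/\delta)=0$ for $u<\epsilon\delta$, the first is effectively over $[\epsilon\delta,\delta]$). The integral is said to exist if the limit exists (as a finite number) for some initialization function $w$, and its value is that limit. Termination function: a finite real-valued function $z$ on $\mathbb{R}$, not depending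 on $b$, for which there is $c\ge 0$ such that $z(x)=1$ for $x\le 0$, $z(x)=0$ for $x>c$, and $z'(x)\le 0$ (i.e. $z$ is nonincreasing; $z'$ need not exist classically everywhere). Generalized infinite-limit integral: for a termination function $z$ with associated $c$, $$Z\!\!\int_{a}^{\infty} f(x)\,dx=\lim_{b\to\infty}\left\{\int_a^b f(x)\,dx+\int_b^{b+c} f(x)\,z(x-b)\,dx\right\}.$$ It is said to exist if the limit exists (as a finite number) for some termination function $z$, and its value is that limit. *)

theory Defs
  imports "HOL-Analysis.Analysis"
begin

definition initialization_function :: "(real \<Rightarrow> real) \<Rightarrow> bool" where
  "initialization_function w \<longleftrightarrow>
     (\<exists>\<epsilon>. 0 < \<epsilon> \<and> \<epsilon> \<le> 1 \<and> (\<forall>v. v < \<epsilon> \<longrightarrow> w v = 0)) \<and> (\<forall>v. 1 \<le> v \<longrightarrow> w v = 1) \<and> mono w"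

definition termination_function :: "(real \<Rightarrow> real) \<Rightarrow> real \<Rightarrow> bool" where
  "termination_function z c \<longleftrightarrow>
     0 \<le> c \<and> (\<forall>x. x \<le> 0 \<longrightarrow> z x = 1) \<and> (\<forall>x. c < x \<longrightarrow> z x = 0) \<and> antimono z"

text \<open>The conventional integrals are Lebesgue integrals. Their existence is part of the two
  predicates below, since a set integral that does not exist is 0 by convention. The weighted
  integrands need no condition of their own: a monotone bounded weight preserves integrability,
  and the weight \<open>w (u / \<delta>)\<close> vanishes for \<open>u < \<epsilon> * \<delta>\<close>, so the values of \<open>g\<close> near and at the
  critical limit 0 are irrelevant.\<close>

definition has_Z_integral_zero :: "(real \<Rightarrow> real) \<Rightarrow> real \<Rightarrow> real \<Rightarrow> bool" where
  "has_Z_integral_zero g \<beta> I \<longleftrightarrow>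
     (\<forall>\<delta>. 0 < \<delta> \<and> \<delta> < \<beta> \<longrightarrow> set_integrable lebesgue {\<delta>..\<beta>} g) \<and>
     (\<exists>w. initialization_function w \<and>
        ((\<lambda>\<delta>. (LINT u:{0..\<delta>}|lebesgue. g u * w (u / \<delta>)) + (LINT u:{\<delta>..\<beta>}|lebesgue. g u))
           \<longlongrightarrow> I) (at_right 0))"

definition has_Z_integral_infinity :: "(real \<Rightarrow> real) \<Rightarrow> real \<Rightarrow> real \<Rightarrow> bool" where
  "has_Z_integral_infinity f a I \<longleftrightarrow>
     (\<forall>b. a < b \<longrightarrow> set_integrable lebesgue {a..b} f) \<and>
     (\<exists>z c. termination_function z c \<and>
        ((\<lambda>b. (LINT x:{a..b}|lebesgue. f x) + (LINT x:{b..b + c}|lebesgue. f x * z (x - b)))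
           \<longlongrightarrow> I) at_top)"

definition Z_integrable_zero :: "(real \<Rightarrow> real) \<Rightarrow> real \<Rightarrow> bool" where
  "Z_integrable_zero g \<beta> \<longleftrightarrow> (\<exists>I. has_Z_integral_zero g \<beta> I)"

definition Z_integrable_infinity :: "(real \<Rightarrow> real) \<Rightarrow> real \<Rightarrow> bool" where
  "Z_integrable_infinity f a \<longleftrightarrow> (\<exists>I. has_Z_integral_infinity f a I)"

definition Z_integral_zero :: "(real \<Rightarrow> real) \<Rightarrow> real \<Rightarrow> real" where
  "Z_integral_zero g \<beta> = (THE I. has_Z_integral_zero g \<beta> I)"

definition Z_integral_infinity :: "(real \<Rightarrow> real) \<Rightarrow> real \<Rightarrow> real" where
  "Z_integral_infinity f a = (THE I. has_Z_integral_infinity f a I)"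

text \<open>The values do not depend on the chosen weight, so the definite descriptions above are
  well defined. A weighted integral is an average, over cut-off points, of plain integrals; two such
  averages commute by Fubini.\<close>

lemma sigma_finite_lebesgue: "sigma_finite_measure (lebesgue :: real measure)"
proof (rule sigma_finite_measure.intro)
  obtain A :: "nat \<Rightarrow> real set" where A: "range A \<subseteq> sets lborel" "(\<Union>i. A i) = space lborel"
    "\<And>i. emeasure lborel (A i) \<noteq> \<infinity>"
    using lborel.sigma_finite by metis
  show "\<exists>A. countable A \<and> A \<subseteq> sets lebesgue \<and> \<Union> A = space lebesgue \<and>
      (\<forall>a\<in>A. emeasure (lebesgue :: real measure) a \<noteq> \<infinity>)"
    using A by (intro exI[of _ "range A"]) (auto simp: image_subset_iff)
qed

text \<open>Layer-cake representation: averaging over the level \<open>s\<close> turns a weight into cut-offs.\<close>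

lemma layer_cake:
  fixes h W :: "real \<Rightarrow> real"
  assumes h: "integrable lebesgue h" and W[measurable]: "W \<in> borel_measurable borel"
    and W01: "\<And>x. 0 \<le> W x" "\<And>x. W x \<le> 1"
  shows "(LINT x|lebesgue. h x * W x)
       = (LINT s:{0..<1}|lborel. (LINT x|lebesgue. h x * indicator {x. s < W x} x))"
proof -
  interpret sigma_finite_measure "lebesgue :: real measure" by (rule sigma_finite_lebesgue)
  interpret pair_sigma_finite "lebesgue :: real measure" "lborel :: real measure" ..
  have hm[measurable]: "h \<in> borel_measurable lebesgue" using h by auto
  have Wm[measurable]: "W \<in> borel_measurable lebesgue"
    using W by (simp add: measurable_completion)
  let ?k = "\<lambda>x s. indicator {0..<1::real} s * (h x * indicator {x. s < W x} x)"
  have meas: "case_prod ?k \<in> borel_measurable (lebesgue \<Otimes>\<^sub>M lborel)"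
    unfolding indicator_def by measurable
  have "integrable (lebesgue \<Otimes>\<^sub>M lborel) (case_prod ?k)"
  proof (rule Fubini_integrable[OF meas, unfolded prod.case])
    have "(LINT s|lborel. norm (?k x s)) = \<bar>h x\<bar> * W x" for x
    proof -
      have "(LINT s|lborel. norm (?k x s)) = (LINT s|lborel. \<bar>h x\<bar> * indicator {0..<W x} s)"
        by (intro Bochner_Integration.integral_cong)
           (use W01[of x] in \<open>auto simp: indicator_def\<close>)
      then show ?thesis using W01(1)[of x] by simp
    qed
    moreover have "integrable lebesgue (\<lambda>x. \<bar>h x\<bar> * W x)"
      by (rule Bochner_Integration.integrable_bound[OF h])
         (use W01 in \<open>auto simp: abs_mult mult_left_le\<close>)
    ultimately show "integrable lebesgue (\<lambda>x. LINT s|lborel. norm (?k x s))" by simp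
    show "AE x in lebesgue. integrable lborel (?k x)"
    proof (rule AE_I2)
      fix x
      have "?k x = (\<lambda>s. h x * indicator {0..<W x} s)"
        using W01[of x] by (auto simp: indicator_def fun_eq_iff)
      moreover have "integrable lborel (\<lambda>s. h x * indicator {0..<W x} s)"
        using W01(1)[of x] by (intro integrable_mult_right integrable_real_indicator) auto
      ultimately show "integrable lborel (?k x)" by simp
    qed
  qed
  from Fubini_integral[OF this]
  have "(LINT s|lborel. LINT x|lebesgue. ?k x s) = (LINT x|lebesgue. LINT s|lborel. ?k x s)" .
  moreover have "(LINT s|lborel. ?k x s) = h x * W x" for x
  proof -
    have "?k x = (\<lambda>s. h x * indicator {0..<W x} s)"
      using W01[of x] by (auto simp: indicator_def fun_eq_iff)
    then show ?thesis using W01(1)[of x] by simp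
  qed
  ultimately show ?thesis by (simp add: set_lebesgue_integral_def)
qed

definition cutoff :: "(real \<Rightarrow> real) \<Rightarrow> real \<Rightarrow> real" where
  "cutoff z s = (if 0 \<le> s \<and> s < 1 then Sup {x. s < z x} else 0)"

context
  fixes z c assumes z: "termination_function z c"
begin

lemma termD: "0 \<le> c" "x \<le> 0 \<Longrightarrow> z x = 1" "c < x \<Longrightarrow> z x = 0" "x \<le> y \<Longrightarrow> z y \<le> z x"
  using z by (auto simp: termination_function_def antimono_def)

lemma term_range: "0 \<le> z x" "z x \<le> 1"
proof -
  show "0 \<le> z x" using termD(3)[of "max x (c + 1)"] termD(4)[of x "max x (c + 1)"] by auto
  show "z x \<le> 1" using termD(2)[of "min x 0"] termD(4)[of "min x 0" x] by auto
qed

lemma term_measurable: "z \<in> borel_measurable borel"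
proof -
  have "mono (\<lambda>x. - z x)" using termD(4) by (auto simp: mono_def)
  from borel_measurable_uminus[OF borel_measurable_mono[OF this]] show ?thesis by simp
qed

lemma level_bdd: "0 \<le> s \<Longrightarrow> bdd_above {x. s < z x}"
  by (intro bdd_aboveI[of _ c]) (metis mem_Collect_eq not_less termD(3))

lemma level_ne: "s < 1 \<Longrightarrow> {x. s < z x} \<noteq> {}"
  using termD(2)[of 0] by (metis empty_iff mem_Collect_eq order_refl)

lemma cutoff_range: "0 \<le> cutoff z s" "cutoff z s \<le> c"
proof -
  show "0 \<le> cutoff z s"
    using level_bdd[of s] termD(2)[of 0] by (auto simp: cutoff_def intro!: cSup_upper)
  have "Sup {x. s < z x} \<le> c" if "0 \<le> s" "s < 1"
    using that by (intro cSup_least level_ne) (metis mem_Collect_eq not_less termD(3))+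
  then show "cutoff z s \<le> c" using termD(1) by (auto simp: cutoff_def)
qed

lemma less_cutoff: assumes "0 \<le> s" "s < 1" "x < cutoff z s" shows "s < z x"
proof -
  have "\<exists>y\<in>{x. s < z x}. x < y"
    using assms less_cSup_iff[OF level_ne[OF assms(2)] level_bdd[OF assms(1)], of x]
    by (auto simp: cutoff_def)
  then obtain y where "s < z y" "x < y" by auto
  with termD(4)[of x y] show ?thesis by simp
qed

lemma le_cutoff: "0 \<le> s \<Longrightarrow> s < 1 \<Longrightarrow> s < z x \<Longrightarrow> x \<le> cutoff z s"
  using level_bdd[of s] by (auto simp: cutoff_def intro!: cSup_upper)

lemma cutoff_measurable: "cutoff z \<in> borel_measurable borel"
proof -
  have "mono_on {0..<1} (\<lambda>s. - cutoff z s)"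
  proof (rule mono_onI)
    fix r s :: real assume "r \<in> {0..<1}" "s \<in> {0..<1}" "r \<le> s"
    then show "- cutoff z r \<le> - cutoff z s"
      using level_ne[of s] level_bdd[of r]
      by (simp add: cutoff_def) (intro cSup_subset_mono, auto)
  qed
  then have "(\<lambda>s. - cutoff z s) \<in> borel_measurable (restrict_space borel {0..<1})"
    by (rule borel_measurable_mono_on_fnc)
  then have "(\<lambda>s. indicator {0..<1::real} s *\<^sub>R (- cutoff z s)) \<in> borel_measurable borel"
    by (subst (asm) borel_measurable_restrict_space_iff) auto
  from borel_measurable_uminus[OF this]
  have "(\<lambda>s. - (indicator {0..<1::real} s *\<^sub>R (- cutoff z s))) \<in> borel_measurable borel" .
  moreover have "(\<lambda>s. - (indicator {0..<1::real} s *\<^sub>R (- cutoff z s))) = cutoff z"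
    by (auto simp: fun_eq_iff cutoff_def indicator_def)
  ultimately show ?thesis by simp
qed

end

lemma averages_same_limit:
  fixes \<Phi> :: "real \<Rightarrow> real"
  assumes \<Phi>: "continuous_on UNIV \<Phi>"
    and z1: "termination_function z1 c1" and z2: "termination_function z2 c2"
    and L1: "((\<lambda>b. LINT s:{0..<1}|lborel. \<Phi> (b + cutoff z1 s)) \<longlongrightarrow> L1) at_top"
    and L2: "((\<lambda>b. LINT s:{0..<1}|lborel. \<Phi> (b + cutoff z2 s)) \<longlongrightarrow> L2) at_top"
  shows "L1 = L2"
proof -
  let ?M = "restrict_space lborel {0..<1::real}"
  have P: "finite_measure ?M" "measure ?M (space ?M) = 1"
    by (rule finite_measureI) (simp_all add: measure_restrict_space space_restrict_space emeasure_restrict_space)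
  interpret P: finite_measure ?M by (rule P)
  interpret PP: pair_sigma_finite ?M ?M ..
  note [measurable] = borel_measurable_continuous_onI[OF \<Phi>]
  have cm: "cutoff z1 \<in> borel_measurable borel" "cutoff z2 \<in> borel_measurable borel"
    using cutoff_measurable[OF z1] cutoff_measurable[OF z2] .
  have [measurable]: "cutoff z1 \<in> borel_measurable ?M" "cutoff z2 \<in> borel_measurable ?M"
    using cm by (auto intro!: measurable_restrict_space1)
  have conv: "(LINT s:{0..<1}|lborel. h s) = (LINT s|?M. h s)" for h :: "real \<Rightarrow> real"
    by (simp add: set_lebesgue_integral_def integral_restrict_space)
  have bound: "\<exists>B. \<forall>s r. \<bar>\<Phi> (b + cutoff z1 s + cutoff z2 r)\<bar> \<le> B" for b
  proof -
    have "compact (\<Phi> ` {b..b + c1 + c2})"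
      using \<Phi> by (intro compact_continuous_image) (auto intro: continuous_on_subset)
    then obtain B where B: "\<forall>y\<in>\<Phi> ` {b..b + c1 + c2}. norm y \<le> B"
      using compact_imp_bounded[THEN bounded_iff[THEN iffD1]] by metis
    have "b + cutoff z1 s + cutoff z2 r \<in> {b..b + c1 + c2}" for s r
      using cutoff_range[OF z1, of s] cutoff_range[OF z2, of r] by auto
    then have "\<bar>\<Phi> (b + cutoff z1 s + cutoff z2 r)\<bar> \<le> B" for s r
      using B by (metis image_eqI real_norm_def)
    then show ?thesis by blast
  qed
  define H where "H b = (LINT s|?M. LINT r|?M. \<Phi> (b + cutoff z1 s + cutoff z2 r))" for b
  have int: "integrable (?M \<Otimes>\<^sub>M ?M) (\<lambda>(s, r). \<Phi> (b + cutoff z1 s + cutoff z2 r))" for b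
  proof -
    obtain B where "\<And>s r. \<bar>\<Phi> (b + cutoff z1 s + cutoff z2 r)\<bar> \<le> B" using bound by blast
    then show ?thesis 
      by (intro finite_measure.integrable_const_bound[OF finite_measure_pair_measure[OF P(1) P(1)], of _ B])
         (auto simp: split_beta)
  qed
  have H2: "H b = (LINT r|?M. LINT s|?M. \<Phi> (b + cutoff z1 s + cutoff z2 r))" for b
    unfolding H_def by (rule PP.Fubini_integral[OF int, symmetric])
  have avg: "((\<lambda>b. LINT s|?M. K (b + T s)) \<longlongrightarrow> L) at_top"
    if K: "(K \<longlongrightarrow> L) at_top" and T: "\<And>s. 0 \<le> T s"
      and i: "\<And>b. integrable ?M (\<lambda>s. K (b + T s))" for K T :: "real \<Rightarrow> real" and L
  proof (rule tendstoI)
    fix e :: real assume "e > 0"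
    then obtain N where N: "\<And>y. y \<ge> N \<Longrightarrow> dist (K y) L < e / 2"
      using tendstoD[OF K, of "e / 2"] by (auto simp: eventually_at_top_linorder)
    have "dist (LINT s|?M. K (b + T s)) L < e" if "b \<ge> N" for b
    proof -
      have *: "K (b + T s) \<le> L + e / 2" "L - e / 2 \<le> K (b + T s)" for s
        using N[of "b + T s"] T[of s] that unfolding dist_real_def by linarith+
      have "(LINT s|?M. K (b + T s)) \<le> (LINT s|?M. L + e / 2)"
        by (rule integral_mono[OF i P.integrable_const *(1)])
      moreover have "(LINT s|?M. L - e / 2) \<le> (LINT s|?M. K (b + T s))"
        by (rule integral_mono[OF P.integrable_const i *(2)])
      ultimately show ?thesis using \<open>e > 0\<close> P(2) unfolding dist_real_def lebesgue_integral_const by simp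
    qed
    then show "\<forall>\<^sub>F b in at_top. dist (LINT s|?M. K (b + T s)) L < e"
      by (auto simp: eventually_at_top_linorder)
  qed
  have "(H \<longlongrightarrow> L1) at_top"
  proof -
    have "integrable ?M (\<lambda>r. LINT s|?M. \<Phi> (b + cutoff z2 r + cutoff z1 s))" for b
      using PP.integrable_snd[OF int, of b] by (simp add: ac_simps)
    then have "((\<lambda>b. LINT r|?M. LINT s|?M. \<Phi> (b + cutoff z2 r + cutoff z1 s)) \<longlongrightarrow> L1) at_top"
      by (intro avg[where T = "cutoff z2"]) (use L1 cutoff_range[OF z2] in \<open>auto simp: conv\<close>)
    then show "((\<lambda>b. H b) \<longlongrightarrow> L1) at_top" unfolding H2 by (simp add: ac_simps)
  qed
  moreover have "((\<lambda>b. H b) \<longlongrightarrow> L2) at_top"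
    unfolding H_def
    by (intro avg[where T = "cutoff z1"])
       (use L2 cutoff_range[OF z1] PP.integrable_fst[OF int] in \<open>auto simp: conv\<close>)
  ultimately show ?thesis by (intro tendsto_unique[of at_top H]) auto
qed

lemma AE_eq_off_point:
  fixes h1 h2 :: "real \<Rightarrow> real"
  assumes "\<And>x. x \<noteq> p \<Longrightarrow> h1 x = h2 x"
    and "h1 \<in> borel_measurable lebesgue" "h2 \<in> borel_measurable lebesgue"
  shows "(LINT x|lebesgue. h1 x) = (LINT x|lebesgue. h2 x)"
  using assms by (intro integral_cong_AE AE_I[of _ _ "{p}"]) auto

lemma has_Z_integral_infinity_unique:
  assumes "has_Z_integral_infinity f a I" "has_Z_integral_infinity f a J"
  shows "I = J"
proof -
  have f: "set_integrable lebesgue {a..b} f" for b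
  proof -
    have "set_integrable lebesgue {a..max b (a + 1)} f"
      using assms(1) by (simp add: has_Z_integral_infinity_def)
    then show ?thesis by (rule set_integrable_subset) auto
  qed
  define F where "F y = (LINT x:{a..y}|lebesgue. f x)" for y
  have "continuous_on UNIV F"
  proof -
    have "isCont F y" for y
    proof -
      define N where "N = \<bar>a\<bar> + \<bar>y\<bar> + 1"
      have F: "F t = integral {a..max a t} f" for t
        unfolding F_def using set_lebesgue_integral_eq_integral(2)[OF f[of t]]
        by (cases "a \<le> t") (auto simp: max_def)
      have "f integrable_on {a..N}" using set_lebesgue_integral_eq_integral(1)[OF f] .
      then have "continuous_on {a..N} (\<lambda>t. integral {a..t} f)"
        by (rule indefinite_integral_continuous_1)
      then have "continuous_on {..<N} (\<lambda>t. integral {a..max a t} f)"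
        by (rule continuous_on_compose2) (auto intro!: continuous_intros simp: N_def)
      then show ?thesis
        unfolding F[abs_def] by (rule continuous_on_interior) (simp add: N_def interior_open)
    qed
    then show ?thesis by (simp add: continuous_on_eq_continuous_at)
  qed
  note cont = this
  have conv: "((\<lambda>b. LINT s:{0..<1}|lborel. F (b + cutoff z s)) \<longlongrightarrow> K) at_top"
    if z: "termination_function z c" and
       lim: "((\<lambda>b. (LINT x:{a..b}|lebesgue. f x) + (LINT x:{b..b + c}|lebesgue. f x * z (x - b)))
           \<longlongrightarrow> K) at_top" for z c K
  proof (rule Lim_transform_eventually[OF lim])
    note [measurable] = term_measurable[OF z]
    show "\<forall>\<^sub>F b in at_top. (LINT x:{a..b}|lebesgue. f x) + (LINT x:{b..b + c}|lebesgue. f x * z (x - b))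
        = (LINT s:{0..<1}|lborel. F (b + cutoff z s))"
      using eventually_gt_at_top[of a]
    proof eventually_elim
      case (elim b)
      define h where "h x = indicator {a..b + c} x * f x" for x
      have h: "integrable lebesgue h" using f[of "b + c"] by (simp add: set_integrable_def h_def[abs_def])
      have zm: "(\<lambda>x. z (x - b)) \<in> borel_measurable borel" by measurable
      have zl: "(\<lambda>x. z (x - b)) \<in> borel_measurable lebesgue"
        using zm by (intro measurable_completion) simp
      have "integrable lebesgue (\<lambda>x. h x * z (x - b))"
        by (rule Bochner_Integration.integrable_bound[OF h])
           (use term_range[OF z] borel_measurable_times[OF borel_measurable_integrable[OF h] zl]
             in \<open>auto simp: abs_mult mult_left_le\<close>)
      then have int: "set_integrable lebesgue {a..b + c} (\<lambda>x. f x * z (x - b))"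
        by (simp add: set_integrable_def h_def ac_simps)
      have c: "c \<ge> 0" by (rule termD(1)[OF z])
      have "(LINT x:{a..b}|lebesgue. f x) = (LINT x:{a..b}|lebesgue. f x * z (x - b))"
        by (intro set_lebesgue_integral_cong) (auto simp: termD(2)[OF z])
      moreover have "(LINT x:{a..b} \<union> {b..b + c}|lebesgue. f x * z (x - b)) =
         (LINT x:{a..b}|lebesgue. f x * z (x - b)) + (LINT x:{b..b + c}|lebesgue. f x * z (x - b))"
        using elim c by (intro set_integral_Un_AE AE_I[of _ _ "{b}"] set_integrable_subset[OF int]) auto
      moreover have "{a..b} \<union> {b..b + c} = {a..b + c}" using elim c by auto
      ultimately have "(LINT x:{a..b}|lebesgue. f x) + (LINT x:{b..b + c}|lebesgue. f x * z (x - b))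
         = (LINT x|lebesgue. h x * z (x - b))"
        by (simp add: set_lebesgue_integral_def h_def ac_simps)
      also have "\<dots> = (LINT s:{0..<1}|lborel. (LINT x|lebesgue. h x * indicator {x. s < z (x - b)} x))"
        using term_range[OF z] by (intro layer_cake h zm) auto
      also have "\<dots> = (LINT s:{0..<1}|lborel. F (b + cutoff z s))"
      proof -
        have eq: "(LINT x|lebesgue. h x * indicator {x. s < z (x - b)} x) = F (b + cutoff z s)"
          if s: "0 \<le> s" "s < 1" for s
          unfolding F_def set_lebesgue_integral_def
        proof (rule AE_eq_off_point[of "b + cutoff z s"])
          fix x assume x: "x \<noteq> b + cutoff z s"
          have "s < z (x - b) \<longleftrightarrow> x \<le> b + cutoff z s"
            using less_cutoff[OF z s, of "x - b"] le_cutoff[OF z s, of "x - b"] x by auto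
          then show "h x * indicator {x. s < z (x - b)} x = indicator {a..b + cutoff z s} x *\<^sub>R f x"
            using cutoff_range[OF z, of s] by (auto simp: h_def indicator_def)
        next
          have "Measurable.pred borel (\<lambda>x. s < z (x - b))" using zm by measurable
          then have "{x. s < z (x - b)} \<in> sets lebesgue" by (auto simp: pred_def)
          then show "(\<lambda>x. h x * indicator {x. s < z (x - b)} x) \<in> borel_measurable lebesgue"
            using h by (intro borel_measurable_times borel_measurable_indicator) auto
          show "(\<lambda>x. indicator {a..b + cutoff z s} x *\<^sub>R f x) \<in> borel_measurable lebesgue"
            using f[of "b + cutoff z s"] unfolding set_integrable_def by auto
        qed
        show ?thesis by (intro set_lebesgue_integral_cong) (auto simp: eq)
      qed
      finally show ?case .
    qed
  qed
  obtain z1 c1 z2 c2 where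
    z1: "termination_function z1 c1"
      "((\<lambda>b. (LINT x:{a..b}|lebesgue. f x) + (LINT x:{b..b + c1}|lebesgue. f x * z1 (x - b)))
           \<longlongrightarrow> I) at_top" and
    z2: "termination_function z2 c2"
      "((\<lambda>b. (LINT x:{a..b}|lebesgue. f x) + (LINT x:{b..b + c2}|lebesgue. f x * z2 (x - b)))
           \<longlongrightarrow> J) at_top"
    using assms unfolding has_Z_integral_infinity_def by (elim conjE exE) (rule that)
  show ?thesis
    by (rule averages_same_limit[OF cont z1(1) z2(1) conv[OF z1] conv[OF z2]])
qed

lemma has_Z_integral_zero_unique:
  assumes "has_Z_integral_zero g \<beta> I" "has_Z_integral_zero g \<beta> J" and "0 < \<beta>"
  shows "I = J"
proof -
  have g: "set_integrable lebesgue {d..\<beta>} g" if "0 < d" for d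
  proof -
    have "set_integrable lebesgue {min d (\<beta> / 2)..\<beta>} g"
      using assms(1,3) that by (simp add: has_Z_integral_zero_def)
    then show ?thesis by (rule set_integrable_subset) auto
  qed
  define F where "F x = (LINT u:{exp (- x)..\<beta>}|lebesgue. g u)" for x
  have cont: "continuous_on UNIV F"
  proof -
    have "isCont F x" for x
    proof -
      define d where "d = min \<beta> (exp (- (x + 1)))"
      have d: "0 < d" "d \<le> \<beta>" using assms(3) by (auto simp: d_def)
      have F: "F t = integral {min \<beta> (exp (- t))..\<beta>} g" for t
        unfolding F_def using set_lebesgue_integral_eq_integral(2)[OF g[of "exp (- t)"]]
        by (cases "exp (- t) \<le> \<beta>") (auto simp: min_def)
      have "g integrable_on {d..\<beta>}" using set_lebesgue_integral_eq_integral(1)[OF g[OF d(1)]] .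
      then have "continuous_on {d..\<beta>} (\<lambda>t. integral {t..\<beta>} g)"
        by (rule indefinite_integral_continuous_1')
      then have "continuous_on {..<x + 1} (\<lambda>t. integral {min \<beta> (exp (- t))..\<beta>} g)"
        
        by (rule continuous_on_compose2)
           (auto intro!: continuous_intros simp: d_def min_le_iff_disj)
      then show ?thesis
        unfolding F[abs_def] by (rule continuous_on_interior) (simp add: interior_open)
    qed
    then show ?thesis by (simp add: continuous_on_eq_continuous_at)
  qed
  have conv: "\<exists>z c. termination_function z c \<and>
      ((\<lambda>b. LINT s:{0..<1}|lborel. F (b + cutoff z s)) \<longlongrightarrow> K) at_top"
    if w: "initialization_function w" and
       lim: "((\<lambda>\<delta>. (LINT u:{0..\<delta>}|lebesgue. g u * w (u / \<delta>)) + (LINT u:{\<delta>..\<beta>}|lebesgue. g u))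
           \<longlongrightarrow> K) (at_right 0)" for w K
  proof -
    obtain \<epsilon> where \<epsilon>: "0 < \<epsilon>" "\<epsilon> \<le> 1" and w0: "\<And>v. v < \<epsilon> \<Longrightarrow> w v = 0"
      and w1: "\<And>v. 1 \<le> v \<Longrightarrow> w v = 1" and wm: "mono w"
      using w unfolding initialization_function_def by blast
    have w01: "0 \<le> w v" "w v \<le> 1" for v
      using monoD[OF wm, of "min v (\<epsilon> / 2)" v] monoD[OF wm, of v "max v 1"]
        w0[of "min v (\<epsilon> / 2)"] w1[of "max v 1"] \<epsilon> by auto
    note [measurable] = borel_measurable_mono[OF wm]
    define z where "z x = w (exp (- x))" for x
    define c where "c = - ln \<epsilon>"
    have exp_c: "exp (- c) = \<epsilon>" using \<epsilon> by (simp add: c_def)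
    have z: "termination_function z c"
      unfolding termination_function_def
    proof (intro conjI allI impI)
      show "0 \<le> c" using \<epsilon> by (simp add: c_def)
      show "z x = 1" if "x \<le> 0" for x using that by (simp add: z_def w1)
      show "z x = 0" if "c < x" for x
      proof -
        have "exp (- x) < exp (- c)" using that by simp
        then show ?thesis unfolding exp_c z_def by (rule w0)
      qed
      show "antimono z" unfolding z_def by (intro antimonoI monoD[OF wm]) simp
    qed
    have "((\<lambda>b. (LINT u:{0..exp (- b)}|lebesgue. g u * w (u / exp (- b)))
        + (LINT u:{exp (- b)..\<beta>}|lebesgue. g u)) \<longlongrightarrow> K) at_top"
    proof (rule filterlim_compose[OF lim])
      show "filterlim (\<lambda>b::real. exp (- b)) (at_right 0) at_top"
        by (intro tendsto_imp_filterlim_at_right filterlim_compose[OF exp_at_bot]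
             filterlim_uminus_at_bot_at_top) auto
    qed
    then have "((\<lambda>b. LINT s:{0..<1}|lborel. F (b + cutoff z s)) \<longlongrightarrow> K) at_top"
    proof (rule Lim_transform_eventually)
      show "\<forall>\<^sub>F b in at_top. (LINT u:{0..exp (- b)}|lebesgue. g u * w (u / exp (- b)))
          + (LINT u:{exp (- b)..\<beta>}|lebesgue. g u) = (LINT s:{0..<1}|lborel. F (b + cutoff z s))"
        using eventually_gt_at_top[of "- ln \<beta>"]
      proof eventually_elim
        case (elim b)
        define d where "d = exp (- b)"
        have "exp (- b) < exp (ln \<beta>)" using elim by (subst exp_less_cancel_iff) simp
        then have d: "0 < d" "d < \<beta>" using assms(3) by (auto simp: d_def)
        have ed: "0 < \<epsilon> * d" "\<epsilon> * d \<le> d" using \<epsilon> d by (auto simp: mult_le_cancel_right1)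
        define h where "h u = indicator {\<epsilon> * d..\<beta>} u * g u" for u
        have h: "integrable lebesgue h" using g[OF ed(1)] by (simp add: set_integrable_def h_def[abs_def])
        have zm: "(\<lambda>u. w (u / d)) \<in> borel_measurable borel" by measurable
        have zl: "(\<lambda>u. w (u / d)) \<in> borel_measurable lebesgue"
          using zm by (intro measurable_completion) simp
        have "integrable lebesgue (\<lambda>u. h u * w (u / d))"
          by (rule Bochner_Integration.integrable_bound[OF h])
             (use w01 borel_measurable_times[OF borel_measurable_integrable[OF h] zl]
               in \<open>auto simp: abs_mult mult_left_le\<close>)
        then have int: "set_integrable lebesgue {\<epsilon> * d..\<beta>} (\<lambda>u. g u * w (u / d))"
          by (simp add: set_integrable_def h_def ac_simps)
        have low: "w (u / d) = 0" if "u < \<epsilon> * d" for u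
          using that d by (intro w0) (simp add: field_simps)
        have "(LINT u:{d..\<beta>}|lebesgue. g u) = (LINT u:{d..\<beta>}|lebesgue. g u * w (u / d))"
          using d by (intro set_lebesgue_integral_cong) (auto simp: w1)
        moreover have "(LINT u:{0..d}|lebesgue. g u * w (u / d)) = (LINT u:{\<epsilon> * d..d}|lebesgue. g u * w (u / d))"
          unfolding set_lebesgue_integral_def using low ed
          by (intro Bochner_Integration.integral_cong) (auto simp: indicator_def not_le)
        moreover have "(LINT u:{\<epsilon> * d..d} \<union> {d..\<beta>}|lebesgue. g u * w (u / d)) =
           (LINT u:{\<epsilon> * d..d}|lebesgue. g u * w (u / d)) + (LINT u:{d..\<beta>}|lebesgue. g u * w (u / d))"
          using d ed by (intro set_integral_Un_AE AE_I[of _ _ "{d}"] set_integrable_subset[OF int]) auto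
        moreover have "{\<epsilon> * d..d} \<union> {d..\<beta>} = {\<epsilon> * d..\<beta>}" using d ed by auto
        ultimately have "(LINT u:{0..d}|lebesgue. g u * w (u / d)) + (LINT u:{d..\<beta>}|lebesgue. g u)
           = (LINT u|lebesgue. h u * w (u / d))"
          by (simp add: set_lebesgue_integral_def h_def ac_simps)
        also have "\<dots> = (LINT s:{0..<1}|lborel. (LINT u|lebesgue. h u * indicator {u. s < w (u / d)} u))"
          using w01 by (intro layer_cake h zm) auto
        also have "\<dots> = (LINT s:{0..<1}|lborel. F (b + cutoff z s))"
        proof -
          have eq: "(LINT u|lebesgue. h u * indicator {u. s < w (u / d)} u) = F (b + cutoff z s)"
            if s: "0 \<le> s" "s < 1" for s
            unfolding F_def set_lebesgue_integral_def
          proof (rule AE_eq_off_point[of "exp (- (b + cutoff z s))"])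
            let ?p = "exp (- (b + cutoff z s))"
            have "exp (- c) * d \<le> exp (- cutoff z s) * d"
              using cutoff_range(2)[OF z, of s] d by (intro mult_right_mono) auto
            moreover have "?p = exp (- cutoff z s) * d" by (simp add: d_def flip: exp_add)
            ultimately have p: "\<epsilon> * d \<le> ?p" by (simp only: exp_c)
            fix u assume u: "u \<noteq> ?p"
            show "h u * indicator {u. s < w (u / d)} u = indicator {?p..\<beta>} u *\<^sub>R g u"
            proof (cases "\<epsilon> * d \<le> u")
              case True
              then have "0 < u" using ed by linarith
              define y where "y = - ln u - b"
              have y1: "u = exp (- (b + y))"
                using \<open>0 < u\<close> by (simp add: y_def)
              have "exp (- y) = exp (- (b + y)) / d"
                unfolding d_def exp_diff[symmetric] by simp
              then have y: "u = exp (- (b + y))" "u / d = exp (- y)"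
                using y1 by (simp_all only:)
              have "y \<noteq> cutoff z s" using u y(1) by auto
              then have "s < w (u / d) \<longleftrightarrow> y \<le> cutoff z s"
                using less_cutoff[OF z s, of y] le_cutoff[OF z s, of y] unfolding y(2) z_def by linarith
              moreover have "y \<le> cutoff z s \<longleftrightarrow> ?p \<le> u" unfolding y(1) by simp
              ultimately show ?thesis using True by (auto simp: h_def indicator_def)
            next
              case False
              then show ?thesis using p by (auto simp: h_def indicator_def)
            qed
          next
            have "Measurable.pred borel (\<lambda>u. s < w (u / d))" using zm by measurable
            then have "{u. s < w (u / d)} \<in> sets lebesgue" by (auto simp: pred_def)
            then show "(\<lambda>u. h u * indicator {u. s < w (u / d)} u) \<in> borel_measurable lebesgue"
              using h by (intro borel_measurable_times borel_measurable_indicator) auto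
            show "(\<lambda>u. indicator {exp (- (b + cutoff z s))..\<beta>} u *\<^sub>R g u) \<in> borel_measurable lebesgue"
              using g[of "exp (- (b + cutoff z s))"] unfolding set_integrable_def by auto
          qed
          show ?thesis by (intro set_lebesgue_integral_cong) (auto simp: eq)
        qed
        finally show ?case by (simp only: d_def)
      qed
    qed
    with z show ?thesis by blast
  qed
  obtain v w where
    v: "initialization_function v"
      "((\<lambda>\<delta>. (LINT u:{0..\<delta>}|lebesgue. g u * v (u / \<delta>)) + (LINT u:{\<delta>..\<beta>}|lebesgue. g u))
           \<longlongrightarrow> I) (at_right 0)" and
    w: "initialization_function w"
      "((\<lambda>\<delta>. (LINT u:{0..\<delta>}|lebesgue. g u * w (u / \<delta>)) + (LINT u:{\<delta>..\<beta>}|lebesgue. g u))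
           \<longlongrightarrow> J) (at_right 0)"
    using assms(1,2) unfolding has_Z_integral_zero_def by (elim conjE exE) (rule that)
  from conv[OF v] conv[OF w] show ?thesis
    by (elim exE conjE) (rule averages_same_limit[OF cont])
qed

lemma Z_integral_zero_eq:
  "has_Z_integral_zero g \<beta> I \<Longrightarrow> 0 < \<beta> \<Longrightarrow> Z_integral_zero g \<beta> = I"
  unfolding Z_integral_zero_def by (rule the_equality) (assumption | rule has_Z_integral_zero_unique)+

lemma Z_integral_infinity_eq:
  "has_Z_integral_infinity f a I \<Longrightarrow> Z_integral_infinity f a = I"
  unfolding Z_integral_infinity_def by (rule the_equality) (assumption | rule has_Z_integral_infinity_unique)+

end

(* Under u = exp (-\<alpha> x) and \<delta> = exp (-\<alpha> b), a termination function z with bound c and the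
   initialization function w with w (exp (-\<alpha> x)) = z x and \<epsilon> = exp (-\<alpha> c) correspond to each
   other, and the two expressions under the limits are equal as soon as \<delta> \<le> \<beta>. *)
theory Submission
  imports Defs
begin

lemma image_exp_Icc:
  fixes \<alpha> :: real
  assumes "0 < \<alpha>"
  shows "(\<lambda>x. exp (- \<alpha> * x)) ` {a..b} = {exp (- \<alpha> * b)..exp (- \<alpha> * a)}"
proof (intro equalityI subsetI)
  fix u assume u: "u \<in> {exp (- \<alpha> * b)..exp (- \<alpha> * a)}"
  \<comment> \<open>The left end point is an exponential, so \<open>u\<close> has a logarithm and
    the preimage can be solved for explicitly.\<close>
  then have "0 < u" by (auto intro: less_le_trans[OF exp_gt_zero])
  then have "exp (- \<alpha> * (- ln u / \<alpha>)) = u" using assms by simp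
  moreover from this u have "- ln u / \<alpha> \<in> {a..b}"
    using assms by (metis atLeastAtMost_iff exp_le_cancel_iff mult_le_cancel_left_neg neg_less_0_iff_less)
  ultimately show "u \<in> (\<lambda>x. exp (- \<alpha> * x)) ` {a..b}" by (metis image_eqI)
qed (use assms in auto)

context
  fixes \<alpha> :: real
  assumes pos: "0 < \<alpha>"
begin

text \<open>The substitution is decreasing, but the change-of-variables rule uses the absolute value
  of the derivative, so the factor is positive and the image interval has its end points swapped. A
  general \<open>h\<close> allows both plain and weighted integrands.\<close>

lemma change_of_variables_exp:
  fixes h :: "real \<Rightarrow> real"
  shows "set_integrable lebesgue {a..b} (\<lambda>x. \<alpha> * exp (- \<alpha> * x) * h (exp (- \<alpha> * x))) \<longleftrightarrow>
      set_integrable lebesgue {exp (- \<alpha> * b)..exp (- \<alpha> * a)} h" (is "?i1 = ?i2")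
    and "(LINT x:{a..b}|lebesgue. \<alpha> * exp (- \<alpha> * x) * h (exp (- \<alpha> * x))) =
      (LINT u:{exp (- \<alpha> * b)..exp (- \<alpha> * a)}|lebesgue. h u)" (is "?I1 = ?I2")
proof -
  have deriv: "((\<lambda>x. exp (- \<alpha> * x)) has_field_derivative - \<alpha> * exp (- \<alpha> * x)) (at x within {a..b})" for x
    by (auto intro!: derivative_eq_intros)
  have inj: "inj_on (\<lambda>x. exp (- \<alpha> * x)) {a..b}"
    using pos by (auto intro!: inj_onI)
  \<comment> \<open>With the value \<open>K\<close> left free, one equivalence carries both facts:
    integrability transfers, and then the integrals agree.\<close>
  have "?i1 \<and> integral {a..b} (\<lambda>x. \<alpha> * exp (- \<alpha> * x) * h (exp (- \<alpha> * x))) = K \<longleftrightarrow>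
      ?i2 \<and> integral {exp (- \<alpha> * b)..exp (- \<alpha> * a)} h = K" for K
    using has_absolute_integral_change_of_variables_1'[OF _ deriv inj, of h K] pos
    unfolding image_exp_Icc[OF pos] by (simp add: abs_mult)
  then have *: "?i1 \<longleftrightarrow> ?i2"
    "?i1 \<Longrightarrow> integral {a..b} (\<lambda>x. \<alpha> * exp (- \<alpha> * x) * h (exp (- \<alpha> * x)))
      = integral {exp (- \<alpha> * b)..exp (- \<alpha> * a)} h" by blast+
  show "?i1 \<longleftrightarrow> ?i2" by (rule *)
  show "?I1 = ?I2"
  proof (cases ?i1)
    case True
    then show ?thesis using * by (simp add: set_lebesgue_integral_eq_integral(2))
  next
    \<comment> \<open>Neither side is integrable here, so both integrals take the default value
      0.\<close>
    case False
    then show ?thesis using *(1)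
      by (simp add: set_integrable_def set_lebesgue_integral_def not_integrable_integral_eq)
  qed
qed

text \<open>An equality of filters lets a limit in \<delta> be rewritten as a limit in
  \<open>b\<close>, giving both directions of the limit equivalence at once.\<close>

lemma filtermap_exp_at_top: "filtermap (\<lambda>x. exp (- \<alpha> * x)) at_top = at_right 0"
proof (rule filtermap_fun_inverse[where g = "\<lambda>u. - ln u / \<alpha>"])
  show "filterlim (\<lambda>u. - ln u / \<alpha>) at_top (at_right 0)"
    using filterlim_tendsto_pos_mult_at_top[OF tendsto_const _
        ln_at_0[unfolded filterlim_uminus_at_bot], of "1 / \<alpha>"] pos by simp
  show "filterlim (\<lambda>x. exp (- \<alpha> * x)) (at_right 0) at_top"
    using pos by (intro tendsto_imp_filterlim_at_right filterlim_compose[OF exp_at_bot]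
        filterlim_tendsto_neg_mult_at_bot[OF tendsto_const _ filterlim_ident]) auto
  show "\<forall>\<^sub>F x in at_right 0. exp (- \<alpha> * (- ln x / \<alpha>)) = x"
    using pos by (auto simp: eventually_at_right_less elim: eventually_mono[rotated])
qed

text \<open>The map x to exp (-\<alpha> x) is decreasing and sends 0 to 1, so it turns a
  nondecreasing weight into a nonincreasing one. The vanishing of \<open>w\<close> is kept as a
  second conclusion because the integral in \<open>u\<close> starts at 0 rather than at \<epsilon>
  \<delta>.\<close>

lemma initialization_imp_termination:
  assumes "initialization_function w"
  obtains c where "termination_function (\<lambda>x. w (exp (- \<alpha> * x))) c"
    and "\<And>v. v < exp (- \<alpha> * c) \<Longrightarrow> w v = 0"
proof -
  obtain \<epsilon> where \<epsilon>: "0 < \<epsilon>" "\<epsilon> \<le> 1" and w0: "\<And>v. v < \<epsilon> \<Longrightarrow> w v = 0"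
    and w1: "\<And>v. 1 \<le> v \<Longrightarrow> w v = 1" and "mono w"
    using assms unfolding initialization_function_def by blast
  define c where "c = - ln \<epsilon> / \<alpha>"
  have c: "exp (- \<alpha> * c) = \<epsilon>" using \<epsilon> pos by (simp add: c_def)
  have "termination_function (\<lambda>x. w (exp (- \<alpha> * x))) c"
    unfolding termination_function_def
  proof (intro conjI allI impI)
    show "0 \<le> c" using \<epsilon> pos by (simp add: c_def divide_le_0_iff)
    show "w (exp (- \<alpha> * x)) = 1" if "x \<le> 0" for x
      using that pos by (intro w1) (simp add: mult_le_0_iff)
    show "w (exp (- \<alpha> * x)) = 0" if "c < x" for x
      using that pos by (intro w0) (simp flip: c)
    show "antimono (\<lambda>x. w (exp (- \<alpha> * x)))"
      using pos by (intro antimonoI monoD[OF \<open>mono w\<close>]) simp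
  qed
  with that w0 c show ?thesis by simp
qed

lemma termination_imp_initialization:
  assumes "termination_function z c"
  obtains w where "initialization_function w" "\<And>x. w (exp (- \<alpha> * x)) = z x"
    and "\<And>v. v < exp (- \<alpha> * c) \<Longrightarrow> w v = 0"
proof
  \<comment> \<open>Inverting the substitution fixes \<open>w\<close> for positive arguments only;
    the value 0 elsewhere keeps it monotone because \<open>z\<close> is nonnegative.\<close>
  define w where "w v = (if 0 < v then z (- ln v / \<alpha>) else 0)" for v
  note z = termD[OF assms]
  show w0: "w v = 0" if "v < exp (- \<alpha> * c)" for v
  proof (cases "0 < v")
    case True
    \<comment> \<open>Strictness matters: \<open>z\<close> is known to vanish only beyond
      \<open>c\<close>, not at \<open>c\<close> itself.\<close>
    with that have "ln v < - \<alpha> * c" by (metis exp_less_cancel_iff exp_ln)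
    then have "c < - ln v / \<alpha>" using pos by (simp add: field_simps)
    then show ?thesis using True by (simp add: w_def z(3))
  qed (simp add: w_def)
  show "w (exp (- \<alpha> * x)) = z x" for x using pos by (simp add: w_def)
  have "mono w"
  proof
    fix u v :: real assume "u \<le> v"
    moreover have "- ln v / \<alpha> \<le> - ln u / \<alpha>" if "0 < u"
      using that \<open>u \<le> v\<close> pos by (simp add: divide_right_mono)
    ultimately show "w u \<le> w v" using term_range(1)[OF assms] by (auto simp: w_def z(4))
  qed
  moreover have "w v = 1" if "1 \<le> v" for v
    using that pos by (simp add: w_def z(2) divide_le_0_iff)
  \<comment> \<open>The number exp (-\<alpha> c) serves as \<epsilon>; it is at most 1 because
    \<open>c\<close> is nonnegative.\<close>
  moreover have "exp (- \<alpha> * c) \<le> 1" using pos z(1) by simp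
  ultimately show "initialization_function w"
    unfolding initialization_function_def using w0 exp_gt_zero by metis
qed

context
  fixes \<beta> :: real and f g :: "real \<Rightarrow> real"
  assumes \<beta>: "0 < \<beta>"
    and f: "\<And>x. - ln \<beta> / \<alpha> \<le> x \<Longrightarrow> f x = \<alpha> * exp (- \<alpha> * x) * g (exp (- \<alpha> * x))"
begin

lemma exp_lower_limit: "exp (- \<alpha> * (- ln \<beta> / \<alpha>)) = \<beta>"
  using pos \<beta> by simp

lemma integral_exp:
  "(LINT x:{- ln \<beta> / \<alpha>..b}|lebesgue. f x) = (LINT u:{exp (- \<alpha> * b)..\<beta>}|lebesgue. g u)"
proof -
  have "(LINT x:{- ln \<beta> / \<alpha>..b}|lebesgue. f x)
      = (LINT x:{- ln \<beta> / \<alpha>..b}|lebesgue. \<alpha> * exp (- \<alpha> * x) * g (exp (- \<alpha> * x)))"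
    \<comment> \<open>The formula for \<open>f\<close> is assumed only from the lower limit on;
      elsewhere the indicator is 0.\<close>
    unfolding set_lebesgue_integral_def
    by (rule Bochner_Integration.integral_cong) (auto simp: indicator_def f)
  also have "\<dots> = (LINT u:{exp (- \<alpha> * b)..\<beta>}|lebesgue. g u)"
    unfolding change_of_variables_exp(2) exp_lower_limit ..
  finally show ?thesis .
qed

text \<open>A shift by \<open>b\<close> in the exponent becomes division by \<delta> = exp
  (-\<alpha> b). The interval of length \<open>c\<close> is carried to the part of [0, \<delta>]
  above exp (-\<alpha> c) \<delta>, and on the remaining part the weight is 0.\<close>

lemma weighted_integral_exp:
  assumes "- ln \<beta> / \<alpha> \<le> b" and w0: "\<And>v. v < exp (- \<alpha> * c) \<Longrightarrow> w v = 0" and "0 \<le> c"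
  shows "(LINT x:{b..b + c}|lebesgue. f x * w (exp (- \<alpha> * (x - b))))
    = (LINT u:{0..exp (- \<alpha> * b)}|lebesgue. g u * w (u / exp (- \<alpha> * b)))"
proof -
  define h where "h u = g u * w (u / exp (- \<alpha> * b))" for u
  have "exp (- \<alpha> * (x - b)) = exp (- \<alpha> * x) / exp (- \<alpha> * b)" for x
    by (simp add: algebra_simps flip: exp_diff)
  then have "(LINT x:{b..b + c}|lebesgue. f x * w (exp (- \<alpha> * (x - b))))
      = (LINT x:{b..b + c}|lebesgue. \<alpha> * exp (- \<alpha> * x) * h (exp (- \<alpha> * x)))"
    unfolding set_lebesgue_integral_def
    by (intro Bochner_Integration.integral_cong)
       (use assms(1) in \<open>auto simp: indicator_def f h_def\<close>)
  also have "\<dots> = (LINT u:{exp (- \<alpha> * (b + c))..exp (- \<alpha> * b)}|lebesgue. h u)"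
    by (rule change_of_variables_exp)
  also have "\<dots> = (LINT u:{0..exp (- \<alpha> * b)}|lebesgue. h u)"
  proof -
    have "h u = 0" if "u < exp (- \<alpha> * (b + c))" for u
    proof -
      have "exp (- \<alpha> * (b + c)) = exp (- \<alpha> * c) * exp (- \<alpha> * b)"
        by (simp add: algebra_simps flip: exp_add)
      with that have "u / exp (- \<alpha> * b) < exp (- \<alpha> * c)" by (simp add: pos_divide_less_eq)
      then show ?thesis by (simp add: h_def w0)
    qed
    \<comment> \<open>The smaller interval lies inside the larger one since its left end point is
      positive, and on the difference \<open>h\<close> is 0.\<close>
    then show ?thesis unfolding set_lebesgue_integral_def
      by (intro Bochner_Integration.integral_cong)
         (auto simp: indicator_def not_le intro: less_trans[OF _ exp_gt_zero])
  qed
  finally show ?thesis by (simp only: h_def)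
qed

text \<open>Stated for any matching pair of weights, so that it applies whether \<open>w\<close> is
  built from \<open>z\<close> or \<open>z\<close> from \<open>w\<close>.\<close>

lemma weighted_limits_iff:
  assumes z: "termination_function z c" and wz: "\<And>x. w (exp (- \<alpha> * x)) = z x"
    and w0: "\<And>v. v < exp (- \<alpha> * c) \<Longrightarrow> w v = 0"
  shows "((\<lambda>\<delta>. (LINT u:{0..\<delta>}|lebesgue. g u * w (u / \<delta>)) + (LINT u:{\<delta>..\<beta>}|lebesgue. g u))
           \<longlongrightarrow> I) (at_right 0) \<longleftrightarrow>
      ((\<lambda>b. (LINT x:{- ln \<beta> / \<alpha>..b}|lebesgue. f x)
           + (LINT x:{b..b + c}|lebesgue. f x * z (x - b))) \<longlongrightarrow> I) at_top"
  unfolding filtermap_exp_at_top[symmetric] filterlim_filtermap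
proof (rule tendsto_cong)
  show "\<forall>\<^sub>F b in at_top.
      (LINT u:{0..exp (- \<alpha> * b)}|lebesgue. g u * w (u / exp (- \<alpha> * b)))
        + (LINT u:{exp (- \<alpha> * b)..\<beta>}|lebesgue. g u) =
      (LINT x:{- ln \<beta> / \<alpha>..b}|lebesgue. f x) + (LINT x:{b..b + c}|lebesgue. f x * z (x - b))"
    using eventually_ge_at_top[of "- ln \<beta> / \<alpha>"]
    by eventually_elim
       (simp only: integral_exp wz weighted_integral_exp[where w = w, OF _ w0 termD(1)[OF z], symmetric]
          add.commute)
qed

text \<open>The map \<open>b\<close> to exp (-\<alpha> b) is a bijection from the points above the
  lower limit onto the open interval (0, \<beta>), so the integrability clauses of the two
  Z-integrals match one by one.\<close>

lemma set_integrable_exp_iff: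
  "(\<forall>b. - ln \<beta> / \<alpha> < b \<longrightarrow> set_integrable lebesgue {- ln \<beta> / \<alpha>..b} f) \<longleftrightarrow>
   (\<forall>\<delta>. 0 < \<delta> \<and> \<delta> < \<beta> \<longrightarrow> set_integrable lebesgue {\<delta>..\<beta>} g)"
proof -
  have eq: "set_integrable lebesgue {- ln \<beta> / \<alpha>..b} f
      \<longleftrightarrow> set_integrable lebesgue {exp (- \<alpha> * b)..\<beta>} g" for b
  proof -
    have "set_integrable lebesgue {- ln \<beta> / \<alpha>..b} f \<longleftrightarrow>
        set_integrable lebesgue {- ln \<beta> / \<alpha>..b} (\<lambda>x. \<alpha> * exp (- \<alpha> * x) * g (exp (- \<alpha> * x)))"
      by (rule set_integrable_cong) (auto simp: f)
    then show ?thesis unfolding change_of_variables_exp(1) exp_lower_limit .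
  qed
  have less: "- ln \<beta> / \<alpha> < b \<longleftrightarrow> exp (- \<alpha> * b) < \<beta>" for b
  proof -
    have "- ln \<beta> / \<alpha> < b \<longleftrightarrow> - \<alpha> * b < ln \<beta>" using pos by (auto simp: field_simps)
    also have "\<dots> \<longleftrightarrow> exp (- \<alpha> * b) < \<beta>"
      using \<beta> exp_less_cancel_iff[of "- \<alpha> * b" "ln \<beta>"] by simp
    finally show ?thesis .
  qed
  have onto: "\<exists>b. \<delta> = exp (- \<alpha> * b)" if "0 < \<delta>" for \<delta> :: real
    using that pos by (intro exI[of _ "- ln \<delta> / \<alpha>"]) simp
  show ?thesis unfolding eq less using onto exp_gt_zero by metis
qed

lemma has_Z_integral_zero_iff_infinity:
  "has_Z_integral_zero g \<beta> I \<longleftrightarrow> has_Z_integral_infinity f (- ln \<beta> / \<alpha>) I"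
  unfolding has_Z_integral_zero_def has_Z_integral_infinity_def set_integrable_exp_iff
proof (intro conj_cong refl iffI; elim exE conjE)
  fix w assume w: "initialization_function w"
    and lim: "((\<lambda>\<delta>. (LINT u:{0..\<delta>}|lebesgue. g u * w (u / \<delta>))
      + (LINT u:{\<delta>..\<beta>}|lebesgue. g u)) \<longlongrightarrow> I) (at_right 0)"
  obtain c where c: "termination_function (\<lambda>x. w (exp (- \<alpha> * x))) c"
    "\<And>v. v < exp (- \<alpha> * c) \<Longrightarrow> w v = 0"
    by (rule initialization_imp_termination[OF w]) blast
  \<comment> \<open>The termination function is \<open>w\<close> composed with the exponential, so
    the matching condition is reflexivity.\<close>
  from c(1) iffD1[OF weighted_limits_iff[where w = w, OF c(1) refl c(2)] lim]
  show "\<exists>z c. termination_function z c \<and>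
      ((\<lambda>b. (LINT x:{- ln \<beta> / \<alpha>..b}|lebesgue. f x)
        + (LINT x:{b..b + c}|lebesgue. f x * z (x - b))) \<longlongrightarrow> I) at_top"
    by blast
next
  fix z c assume z: "termination_function z c"
    and lim: "((\<lambda>b. (LINT x:{- ln \<beta> / \<alpha>..b}|lebesgue. f x)
      + (LINT x:{b..b + c}|lebesgue. f x * z (x - b))) \<longlongrightarrow> I) at_top"
  obtain w where w: "initialization_function w" "\<And>x. w (exp (- \<alpha> * x)) = z x"
    "\<And>v. v < exp (- \<alpha> * c) \<Longrightarrow> w v = 0"
    by (rule termination_imp_initialization[OF z]) blast
  from w(1) iffD2[OF weighted_limits_iff[where w = w, OF z w(2,3)] lim]
  show "\<exists>w. initialization_function w \<and>
      ((\<lambda>\<delta>. (LINT u:{0..\<delta>}|lebesgue. g u * w (u / \<delta>))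
        + (LINT u:{\<delta>..\<beta>}|lebesgue. g u)) \<longlongrightarrow> I) (at_right 0)"
    by blast
qed

end

end

theorem mainTheorem1:
  fixes \<alpha> \<beta> :: real and f g :: "real \<Rightarrow> real"
  assumes "\<beta> > 0" and "\<alpha> > 0"
    and "\<And>\<delta>. 0 < \<delta> \<Longrightarrow> \<delta> < \<beta> \<Longrightarrow> set_integrable lebesgue {\<delta>..\<beta>} g"
    and "\<And>x. x \<ge> - ln \<beta> / \<alpha> \<Longrightarrow> f x = \<alpha> * exp (- \<alpha> * x) * g (exp (- \<alpha> * x))"
  shows "(Z_integrable_zero g \<beta> \<longleftrightarrow> Z_integrable_infinity f (- ln \<beta> / \<alpha>)) \<and>
         (Z_integrable_zero g \<beta> \<longrightarrow>
            Z_integral_zero g \<beta> = Z_integral_infinity f (- ln \<beta> / \<alpha>))"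
proof -
  \<comment> \<open>The predicates agree as functions of the value, so the existence statements and
    the definite descriptions built from them agree as well.\<close>
  have "has_Z_integral_zero g \<beta> = has_Z_integral_infinity f (- ln \<beta> / \<alpha>)"
    using has_Z_integral_zero_iff_infinity[OF assms(2,1,4)] by blast
  then show ?thesis
    by (simp add: Z_integrable_zero_def Z_integrable_infinity_def
        Z_integral_zero_def Z_integral_infinity_def)
qed

end
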